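(* Let $(K_n,p)$ be a framework in a polyhedral normed space $X=(\mathbb{R}^d,\|\cdot\|_{\mathcal{P}})$ with induced monochrome subgraphs $G_1,\ldots,G_m$. Then $G_1,\ldots,G_m$ are odd-hole-free graphs.
   Context: Let $\mathcal{P}$ be a convex centrally symmetric polytope in $\mathbb{R}^d$ (with the origin in its interior) with facets $\pm F_1,\ldots,\pm F_m$. Each facet $F$ can be written $F=\{x\in\mathcal{P}:x\cdot\hat F=1\}$ for a unique vector $\hat F$. The polyhedral normed space $X=(\mathbb{R}^d,\|\cdot\|_{\mathcal{P}})$ has norm $\|x\|_{\mathcal{P}}=\max_{j\in[m]}|\hat F_j\cdot x|$; this norm is smooth (has a unique support functional) at a unit vector $x_0$ iff exactly one facet contains $x_0$. A framework $(G,p)$ in $X$ is a graph $G=(V,E)$ with $p=(p_v)_{v\in V}\in(\mathbb{R}^d)^V$ such that for every edge $vw$, $p_v\neq p_w$ and $(p_v-p_w)/\|p_v-p_w\|_{\mathcal{P}}$ lies in exactly one facet. $K_n$ is the complete graph on $n$ vertices. For $j\in[m]$, the induced monochrome subgraph $G_j$ has vertex set $V$ and edge set $\{vw\in E: p_v-p_w\in\operatorname{cone}(F_j)\cup\operatorname{cone}(-F_j)\}$, where $\operatorname{cone}$ denotes conical hull. A hole in a graph is an induced subgraph that is a cycle of length at least four; it is odd if the cycle has odd length; a graph is odd-hole-free if it has no odd hole. *)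

theory Defs
  imports "HOL-Analysis.Analysis"
begin

section \<open>Simple graphs and odd holes\<close>

type_synonym 'v graph = "'v set \<times> 'v set set"

abbreviation verts :: "'v graph \<Rightarrow> 'v set" where
  "verts G \<equiv> fst G"

abbreviation edges :: "'v graph \<Rightarrow> 'v set set" where
  "edges G \<equiv> snd G"

definition simple_graph :: "'v graph \<Rightarrow> bool" where
  "simple_graph G \<longleftrightarrow> finite (verts G) \<and> (\<forall>e\<in>edges G. e \<subseteq> verts G \<and> card e = 2)"

definition complete_graph :: "nat \<Rightarrow> 'v graph \<Rightarrow> bool" where
  "complete_graph n G \<longleftrightarrow>
     finite (verts G) \<and> card (verts G) = n \<and> edges G = {e. e \<subseteq> verts G \<and> card e = 2}"

definition induced_subgraph :: "'v graph \<Rightarrow> 'v set \<Rightarrow> 'v graph" where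
  "induced_subgraph G S = (S, {e \<in> edges G. e \<subseteq> S})"

definition cycle_graph :: "nat \<Rightarrow> 'v graph \<Rightarrow> bool" where
  "cycle_graph k H \<longleftrightarrow> k \<ge> 3 \<and>
     (\<exists>c :: nat \<Rightarrow> 'v. inj_on c {..<k} \<and> verts H = c ` {..<k} \<and>
        edges H = {{c i, c (Suc i mod k)} | i. i < k})"

definition hole :: "nat \<Rightarrow> 'v graph \<Rightarrow> 'v graph \<Rightarrow> bool" where
  "hole k H G \<longleftrightarrow>
     (\<exists>S. S \<subseteq> verts G \<and> H = induced_subgraph G S) \<and> cycle_graph k H \<and> k \<ge> 4"

definition odd_hole_free :: "'v graph \<Rightarrow> bool" where
  "odd_hole_free G \<longleftrightarrow> \<not> (\<exists>k H. odd k \<and> hole k H G)"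

section \<open>Polyhedral norms and frameworks\<close>

definition centrally_symmetric_polytope :: "'a::euclidean_space set \<Rightarrow> bool" where
  "centrally_symmetric_polytope P \<longleftrightarrow> polytope P \<and> uminus ` P = P \<and> 0 \<in> interior P"

text \<open>The facets of \<open>P\<close> are \<open>\<plusminus>F\<^sub>1, \<dots>, \<plusminus>F\<^sub>m\<close>, with exactly one facet listed from each
  antipodal pair.\<close>

definition facet_pairs :: "'a::euclidean_space set \<Rightarrow> nat \<Rightarrow> (nat \<Rightarrow> 'a set) \<Rightarrow> bool" where
  "facet_pairs P m F \<longleftrightarrow>
     {A. A facet_of P} = (\<Union>j\<in>{1..m}. {F j, uminus ` F j}) \<and>
     (\<forall>i\<in>{1..m}. \<forall>j\<in>{1..m}. i \<noteq> j \<longrightarrow> F i \<noteq> F j \<and> F i \<noteq> uminus ` F j)"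

text \<open>When \<open>0\<close> is interior to \<open>P\<close>, the affine hull of a facet is a hyperplane avoiding \<open>0\<close>, so
  the vector below exists and is unique.\<close>

definition facet_normal :: "'a::euclidean_space set \<Rightarrow> 'a set \<Rightarrow> 'a" where
  "facet_normal P A = (THE f. A = {x \<in> P. x \<bullet> f = 1})"

definition polyhedral_norm ::
    "'a::euclidean_space set \<Rightarrow> nat \<Rightarrow> (nat \<Rightarrow> 'a set) \<Rightarrow> 'a \<Rightarrow> real" where
  "polyhedral_norm P m F x = Max ((\<lambda>j. \<bar>facet_normal P (F j) \<bullet> x\<bar>) ` {1..m})"

definition framework ::
    "'a::euclidean_space set \<Rightarrow> nat \<Rightarrow> (nat \<Rightarrow> 'a set) \<Rightarrow> 'v graph \<Rightarrow> ('v \<Rightarrow> 'a) \<Rightarrow> bool" where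
  "framework P m F G p \<longleftrightarrow> simple_graph G \<and>
     (\<forall>v w. {v, w} \<in> edges G \<longrightarrow>
        p v \<noteq> p w \<and>
        (\<exists>!A. A facet_of P \<and> (p v - p w) /\<^sub>R polyhedral_norm P m F (p v - p w) \<in> A))"

definition monochrome_subgraph ::
    "(nat \<Rightarrow> 'a::euclidean_space set) \<Rightarrow> 'v graph \<Rightarrow> ('v \<Rightarrow> 'a) \<Rightarrow> nat \<Rightarrow> 'v graph" where
  "monochrome_subgraph F G p j =
     (verts G,
      {{v, w} | v w. {v, w} \<in> edges G \<and>
         p v - p w \<in> (convex_cone hull F j) \<union> (convex_cone hull (uminus ` F j))})"

end

theory Submission
  imports Defs
begin

text \<open>Orient an edge \<open>vw\<close> of \<open>G\<^sub>j\<close> from \<open>v\<close> to \<open>w\<close> if \<open>p\<^sub>v - p\<^sub>w\<close> lies in the cone of \<open>F\<^sub>j\<close>. A convex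
  cone is closed under addition, so this orientation is transitive and \<open>G\<^sub>j\<close> is a comparability
  graph. Two consecutive edges of an induced cycle of length at least four cannot be oriented alike,
  since transitivity would give a chord; so orientations alternate along the cycle, whose length is
  therefore even.\<close>

lemma odd_hole_free_comparability:
  assumes "transp R"
    and edge_iff: "\<And>v w. {v, w} \<in> edges G \<longleftrightarrow>
      v \<in> verts G \<and> w \<in> verts G \<and> v \<noteq> w \<and> (R v w \<or> R w v)"
  shows "odd_hole_free G"
  unfolding odd_hole_free_def
proof (intro notI, elim exE conjE)
  fix k H assume "odd k" and "hole k H G"
  then obtain S c where S: "S \<subseteq> verts G" and H: "H = induced_subgraph G S" and "k \<ge> 4"
    and inj: "inj_on c {..<k}" and vH: "verts H = c ` {..<k}"
    and eH: "edges H = {{c i, c (Suc i mod k)} | i. i < k}"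
    unfolding hole_def cycle_graph_def by blast
  \<comment> \<open>The labelling is extended periodically to all naturals, so that going round the
    cycle needs no special case at the last vertex.\<close>
  define d where "d i = c (i mod k)" for i
  have d_eq: "d i = d j \<longleftrightarrow> i mod k = j mod k" for i j
    using inj_on_eq_iff[OF inj, of "i mod k" "j mod k"] \<open>k \<ge> 4\<close> by (simp add: d_def)
  have mod_ne: "(i + t) mod k \<noteq> i mod k" if "0 < t" "t < k" for i t
    using that mod_eq_dvd_iff_nat[of i "i + t" k] by (auto dest: nat_dvd_not_less)
  have d_verts: "d i \<in> verts G" "d i \<in> S" for i
    using S H vH \<open>k \<ge> 4\<close> by (auto simp: d_def induced_subgraph_def)
  have edge: "R (d i) (d (Suc i)) \<or> R (d (Suc i)) (d i)" for i
  proof -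
    have "{c (i mod k), c (Suc (i mod k) mod k)} \<in> edges H"
      unfolding eH using \<open>k \<ge> 4\<close> by (intro CollectI exI[of _ "i mod k"]) simp
    then have "{d i, d (Suc i)} \<in> edges G"
      unfolding H induced_subgraph_def d_def by (simp add: mod_Suc_eq)
    then show ?thesis using edge_iff by blast
  qed
  \<comment> \<open>\<open>H\<close> is induced, so an edge of \<open>G\<close> between vertices two
    apart would be one of the cycle edges.\<close>
  have no_chord: "\<not> (R (d i) (d (i + 2)) \<or> R (d (i + 2)) (d i))" for i
  proof
    assume R: "R (d i) (d (i + 2)) \<or> R (d (i + 2)) (d i)"
    have ne: "d i \<noteq> d (i + 2)"
      using mod_ne[of 2 i] \<open>k \<ge> 4\<close> by (simp add: d_eq eq_commute del: add_2_eq_Suc')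
    have "{d i, d (i + 2)} \<in> edges H"
      unfolding H induced_subgraph_def using edge_iff ne R d_verts by auto
    then obtain l where l: "l < k" "{d i, d (i + 2)} = {d l, d (Suc l)}"
      using eH by (auto simp: d_def)
    then consider "i mod k = l mod k" "(i + 2) mod k = Suc l mod k"
      | "i mod k = Suc l mod k" "(i + 2) mod k = l mod k"
      by (auto simp: doubleton_eq_iff d_eq)
    then show False
    proof cases
      case 1
      then have "(l + 2) mod k = Suc l mod k" by (metis mod_add_left_eq)
      then show False using mod_ne[of 1 "Suc l"] \<open>k \<ge> 4\<close> by simp
    next
      case 2
      \<comment> \<open>Here \<open>k\<close> would divide 3. This is where length at least four
        matters: in a triangle, vertices two apart are adjacent.\<close>
      then have "(Suc l + 2) mod k = l mod k" by (metis mod_add_left_eq)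
      then show False using mod_ne[of 3 l] \<open>k \<ge> 4\<close> by (simp add: eval_nat_numeral)
    qed
  qed
  \<comment> \<open>If both relations hold, transitivity gives a chord; if both fail,
    \<open>edge\<close> supplies both reversed relations, and these give a chord too.\<close>
  have alternate: "R (d (Suc i)) (d (Suc (Suc i))) \<longleftrightarrow> \<not> R (d i) (d (Suc i))" for i
    using no_chord[of i] edge[of i] edge[of "Suc i"]
      transpD[OF \<open>transp R\<close>, of "d i" "d (Suc i)" "d (Suc (Suc i))"]
      transpD[OF \<open>transp R\<close>, of "d (Suc (Suc i))" "d (Suc i)" "d i"]
    by auto
  have "R (d i) (d (Suc i)) \<longleftrightarrow> (even i \<longleftrightarrow> R (d 0) (d (Suc 0)))" for i
    by (induction i) (auto simp: alternate)
  \<comment> \<open>One odd turn flips the truth value, yet leads back to the same edge.\<close>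
  from this[of k] have "R (d k) (d (Suc k)) \<longleftrightarrow> \<not> R (d 0) (d (Suc 0))"
    using \<open>odd k\<close> by simp
  moreover have "d k = d 0" "d (Suc k) = d (Suc 0)"
    using \<open>k \<ge> 4\<close> by (simp_all add: d_eq mod_Suc)
  ultimately show False by simp
qed

text \<open>Negation is linear, and conic hulls commute with linear images. Hence membership in the
  cone of the opposite facet is \<open>R\<close> with its arguments swapped.\<close>

lemma convex_cone_hull_uminus:
  fixes A :: "'a::real_vector set"
  shows "convex_cone hull (uminus ` A) = uminus ` (convex_cone hull A)"
  using convex_cone_hull_linear_image[of "uminus :: 'a \<Rightarrow> 'a" A]
  by (simp add: linear_iff)

theorem theorem4p3:
  fixes P :: "(real ^ 'd) set"
    and F :: "nat \<Rightarrow> (real ^ 'd) set"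
    and m n :: nat
    and K :: "'v graph"
    and p :: "'v \<Rightarrow> real ^ 'd"
  assumes "centrally_symmetric_polytope P"
    and "facet_pairs P m F"
    and "complete_graph n K"
    and "framework P m F K p"
  shows "\<forall>j\<in>{1..m}. odd_hole_free (monochrome_subgraph F K p j)"
proof
  fix j
  let ?C = "convex_cone hull F j"
  define R where "R v w \<longleftrightarrow> p v - p w \<in> ?C" for v w
  show "odd_hole_free (monochrome_subgraph F K p j)"
  proof (rule odd_hole_free_comparability)
    show "transp R"
    proof (rule transpI)
      fix u v w assume "R u v" "R v w"
      then have "(p u - p v) + (p v - p w) \<in> ?C"
        unfolding R_def by (rule convex_cone_hull_add)
      then show "R u w" by (simp add: R_def)
    qed
  next
    fix v w
    have neg: "x \<in> convex_cone hull (uminus ` F j) \<longleftrightarrow> - x \<in> ?C" for x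
      by (force simp: convex_cone_hull_uminus)
    \<comment> \<open>Completeness turns every pair related by \<open>R\<close> into an edge, so
      transitivity really produces chords.\<close>
    have K: "{v, w} \<in> edges K \<longleftrightarrow> v \<in> verts K \<and> w \<in> verts K \<and> v \<noteq> w"
      using assms(3) by (auto simp: complete_graph_def card_2_iff doubleton_eq_iff)
    have "{v, w} \<in> edges (monochrome_subgraph F K p j) \<longleftrightarrow>
        {v, w} \<in> edges K \<and> (R v w \<or> R w v)"
      unfolding monochrome_subgraph_def
      by (auto simp: neg R_def doubleton_eq_iff insert_commute[of w v])
    then show "{v, w} \<in> edges (monochrome_subgraph F K p j) \<longleftrightarrow>
        v \<in> verts (monochrome_subgraph F K p j) \<and> w \<in> verts (monochrome_subgraph F K p j) \<and>
        v \<noteq> w \<and> (R v w \<or> R w v)"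
      by (simp add: K monochrome_subgraph_def)
  qed
qed

end
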